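(* For all integers $a\geq 2$ and $n\geq 30$, \[\mathrm{ex}_{\Pi}\Bigl(n, 4, \tbinom{4}{2}a +3\Bigr) = \Pi_{2,1}(a,n).\]
   Context: A multigraph is a pair $G=(V,w)$ where $V$ is a finite set and $w:\binom{V}{2}\to\mathbb{Z}_{\geq 0}$ assigns a multiplicity to each pair. For $X\subseteq V$ write $e(G[X])=\sum_{xy\in\binom{X}{2}}w(xy)$ and $P(G)=\prod_{xy\in\binom{V}{2}}w(xy)$. Given integers $s\geq 2$, $q\geq 0$, $\mathcal{F}(n,s,q)$ denotes the set of multigraphs on vertex set $[n]=\{1,\dots,n\}$ in which every $s$-set $X$ of vertices satisfies $e(G[X])\leq q$, and $\mathrm{ex}_{\Pi}(n,s,q)=\max\{P(G): G\in\mathcal{F}(n,s,q)\}$. For positive integers $a,r$, $d\in\{0,1,\dots,a-1\}$ and $n$, $\mathcal{T}_{r,d}(a,n)$ is the set of multigraphs $G$ on $[n]$ whose vertex set can be partitioned into $r$ parts $V_0,\dots,V_{r-1}$ such that all pairs inside $V_0$ have multiplicity $a-d$, all pairs inside $V_i$ ($1\le i\le r-1$) have multiplicity $a$, and all other pairs have multiplicity $a+1$. $\Pi_{r,d}(a,n)=\max\{P(G):G\in\mathcal{T}_{r,d}(a,n)\}$. *)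

theory Defs
  imports Complex_Main "HOL-Library.Ramsey" "HOL-Library.FuncSet" "HOL-Library.Disjoint_Sets"
begin

text \<open>
  A multigraph is a pair of a vertex set and a multiplicity function on the two-element subsets
  of that set. The multiplicity function is extensional, so that it carries no
  information outside its domain. The set of k-element subsets of V is \<^term>\<open>nsets V k\<close>.
\<close>

type_synonym 'a multigraph = "'a set \<times> ('a set \<Rightarrow> nat)"

abbreviation verts :: "'a multigraph \<Rightarrow> 'a set" where
  "verts G \<equiv> fst G"

abbreviation mult :: "'a multigraph \<Rightarrow> 'a set \<Rightarrow> nat" where
  "mult G \<equiv> snd G"

definition multigraph :: "'a multigraph \<Rightarrow> bool" where
  "multigraph G \<longleftrightarrow> finite (verts G) \<and> mult G \<in> nsets (verts G) 2 \<rightarrow>\<^sub>E UNIV"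

definition edge_sum :: "'a multigraph \<Rightarrow> 'a set \<Rightarrow> nat" where
  "edge_sum G X = (\<Sum>e\<in>nsets X 2. mult G e)"

definition edge_prod :: "'a multigraph \<Rightarrow> nat" where
  "edge_prod G = (\<Prod>e\<in>nsets (verts G) 2. mult G e)"

definition sq_graphs :: "nat \<Rightarrow> nat \<Rightarrow> nat \<Rightarrow> nat multigraph set" where
  "sq_graphs n s q = {G. multigraph G \<and> verts G = {1..n} \<and>
     (\<forall>X\<in>nsets {1..n} s. edge_sum G X \<le> q)}"

definition ex_prod :: "nat \<Rightarrow> nat \<Rightarrow> nat \<Rightarrow> nat" where
  "ex_prod n s q = Max (edge_prod ` sq_graphs n s q)"

text \<open>
  The parts of the partition are indexed and may be empty. The subtraction \<open>a - d\<close> is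
  proper for the admissible parameters \<open>d < a\<close>.
\<close>

definition turan_graphs :: "nat \<Rightarrow> nat \<Rightarrow> nat \<Rightarrow> nat \<Rightarrow> nat multigraph set" where
  "turan_graphs r d a n = {G. multigraph G \<and> verts G = {1..n} \<and>
     (\<exists>V :: nat \<Rightarrow> nat set.
        disjoint_family_on V {..<r} \<and> (\<Union>i<r. V i) = {1..n} \<and>
        (\<forall>e\<in>nsets {1..n} 2.
           mult G e = (if e \<subseteq> V 0 then a - d
                       else if \<exists>i\<in>{1..<r}. e \<subseteq> V i then a
                       else a + 1)))}"

definition turan_prod :: "nat \<Rightarrow> nat \<Rightarrow> nat \<Rightarrow> nat \<Rightarrow> nat" where
  "turan_prod r d a n = Max (edge_prod ` turan_graphs r d a n)"

text \<open>
  The maxima above range over finite non-empty sets (the first one only if \<open>2 \<le> s \<le> n\<close>,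
  since for \<open>n < s\<close> the multiplicities are unbounded).
\<close>

lemma finite_bounded_multigraphs:
  "finite {G :: 'a multigraph. multigraph G \<and> verts G = V \<and> (\<forall>e\<in>nsets V 2. mult G e \<le> b)}"
proof (cases "finite V")
  case True
  then have "finite ({V} \<times> (nsets V 2 \<rightarrow>\<^sub>E {..b}))"
    by (intro finite_cartesian_product finite_PiE) (auto simp: finite_imp_finite_nsets)
  then show ?thesis
    by (rule rev_finite_subset) (auto simp: multigraph_def PiE_def)
next
  case False
  then have "{G :: 'a multigraph. multigraph G \<and> verts G = V \<and> (\<forall>e\<in>nsets V 2. mult G e \<le> b)} = {}"
    by (auto simp: multigraph_def)
  then show ?thesis by (simp only: finite.emptyI)
qed

lemma finite_sq_graphs:
  assumes "2 \<le> s" "s \<le> n"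
  shows "finite (sq_graphs n s q)"
proof (rule finite_subset[OF _ finite_bounded_multigraphs[of "{1..n}" q]], rule subsetI)
  fix G assume G: "G \<in> sq_graphs n s q"
  have "mult G e \<le> q" if e: "e \<in> nsets {1..n} 2" for e
  proof -
    have "e \<subseteq> {1..n}" "card e = 2" using e by (auto simp: nsets_def)
    then obtain X where X: "e \<subseteq> X" "X \<subseteq> {1..n}" "card X = s"
      using assms exists_subset_between[of e s "{1..n}"] by auto
    then have fin: "finite X" using finite_subset by blast
    have "mult G e \<le> edge_sum G X"
      unfolding edge_sum_def
      using e X fin by (intro member_le_sum) (auto simp: nsets_def finite_imp_finite_nsets)
    also have "\<dots> \<le> q"
      using G X fin by (auto simp: sq_graphs_def nsets_def)
    finally show ?thesis .
  qed
  then show "G \<in> {G. multigraph G \<and> verts G = {1..n} \<and> (\<forall>e\<in>nsets {1..n} 2. mult G e \<le> q)}"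
    using G by (simp add: sq_graphs_def)
qed

lemma sq_graphs_nonempty: "sq_graphs n s q \<noteq> {}"
proof -
  let ?G = "({1..n}, restrict (\<lambda>_. 0) (nsets {1..n} 2))"
  have "edge_sum ?G X = 0" if "X \<in> nsets {1..n} s" for X
    unfolding edge_sum_def using that by (intro sum.neutral) (auto simp: nsets_def)
  then have "?G \<in> sq_graphs n s q"
    by (simp add: sq_graphs_def multigraph_def)
  then show ?thesis by blast
qed

lemma finite_turan_graphs: "finite (turan_graphs r d a n)"
  by (rule finite_subset[OF _ finite_bounded_multigraphs[of "{1..n}" "a + 1"]])
     (auto simp: turan_graphs_def)

lemma turan_graphs_nonempty:
  assumes "r \<ge> 1"
  shows "turan_graphs r d a n \<noteq> {}"
proof -
  let ?V = "\<lambda>i::nat. if i = 0 then {1..n} else {}"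
  let ?G = "({1..n}, restrict (\<lambda>_. a - d) (nsets {1..n} 2))"
  have "disjoint_family_on ?V {..<r} \<and> (\<Union>i<r. ?V i) = {1..n} \<and>
        (\<forall>e\<in>nsets {1..n} 2.
           mult ?G e = (if e \<subseteq> ?V 0 then a - d
                       else if \<exists>i\<in>{1..<r}. e \<subseteq> ?V i then a
                       else a + 1))"
    using assms by (auto simp: disjoint_family_on_def nsets_def split: if_splits)
  then have "\<exists>V :: nat \<Rightarrow> nat set. disjoint_family_on V {..<r} \<and> (\<Union>i<r. V i) = {1..n} \<and>
        (\<forall>e\<in>nsets {1..n} 2.
           mult ?G e = (if e \<subseteq> V 0 then a - d
                       else if \<exists>i\<in>{1..<r}. e \<subseteq> V i then a
                       else a + 1))"
    by (rule exI[where x = ?V])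
  moreover have "multigraph ?G" by (simp add: multigraph_def)
  ultimately have "?G \<in> turan_graphs r d a n"
    unfolding turan_graphs_def mem_Collect_eq fst_conv by (intro conjI refl)
  then show ?thesis by blast
qed

end

theory Submission
  imports Defs
begin

text \<open>
  Take logarithms and normalise so that multiplicities \<open>a\<close>, \<open>a + 1\<close>, \<open>a - 1\<close> score \<open>0\<close>, \<open>1\<close>, \<open>-l\<close>;
  then \<open>1 \<le> l \<le> 2\<close>, and by concavity of the logarithm the score of \<open>w\<close> is at most \<open>t = w - a\<close>. The
  hypothesis says that \<open>t\<close> sums to at most \<open>3\<close> on every 4-set, and the claim is that the total score
  is at most \<open>m (n - m) - l m (m - 1) / 2\<close> for some \<open>m\<close>. The induction on \<open>n\<close> starts at \<open>n = 6\<close>.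

  A triple with \<open>t\<close>-sum at least \<open>3\<close>, or else a pair with \<open>t \<ge> 2\<close>, receives so little from the other
  vertices that it can be deleted cheaply. Otherwise the graph \<open>H\<close> of pairs with \<open>t = 1\<close> is triangle-free
  and each 4-cycle of \<open>H\<close> has a diagonal with \<open>t < 0\<close>. Let \<open>m\<close> be optimal for \<open>n - 1\<close> vertices. It
  suffices to delete a vertex of score degree at most \<open>m\<close> or at most \<open>n - 1 - m (1 + l)\<close>, the gains
  from enlarging one of the two parts. If a vertex \<open>x\<close> has three \<open>H\<close>-neighbours with no negative pair
  among them (a claw), then the score degree of \<open>x\<close> plus \<open>1 + l\<close> times the average \<open>H\<close>-degree of the
  three is at most \<open>n + l\<close>, so one of the four vertices will do. If there is no claw, every
  \<open>H\<close>-neighbourhood contains so many negative pairs that one of its vertices has small score degree.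
\<close>

section \<open>Sums over pairs and over stars\<close>

definition pair_sum :: "('a set \<Rightarrow> 'b::comm_monoid_add) \<Rightarrow> 'a set \<Rightarrow> 'b" where
  "pair_sum f V = (\<Sum>e\<in>nsets V 2. f e)"

definition star_sum :: "('a set \<Rightarrow> 'b::comm_monoid_add) \<Rightarrow> 'a set \<Rightarrow> 'a \<Rightarrow> 'b" where
  "star_sum f V v = (\<Sum>u\<in>V - {v}. f {v, u})"

lemma doubleton_in_nsets: "\<lbrakk>x \<in> V; y \<in> V; x \<noteq> y\<rbrakk> \<Longrightarrow> {x, y} \<in> nsets V 2"
  by (simp add: nsets_def)

lemma nsets_2E:
  assumes "e \<in> nsets V 2"
  obtains x y where "x \<in> V" "y \<in> V" "x \<noteq> y" "e = {x, y}"
  using assms by (auto simp: nsets_def card_2_iff)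

lemma nsets_2_insert:
  assumes "v \<notin> V"
  shows "nsets (insert v V) 2 = nsets V 2 \<union> (\<lambda>u. {v, u}) ` V"
proof (intro equalityI subsetI)
  fix e assume "e \<in> nsets (insert v V) 2"
  then obtain x y where "x \<in> insert v V" "y \<in> insert v V" "x \<noteq> y" "e = {x, y}"
    by (rule nsets_2E)
  then show "e \<in> nsets V 2 \<union> (\<lambda>u. {v, u}) ` V"
    by (cases "x = v"; cases "y = v") (auto simp: doubleton_in_nsets insert_commute)
next
  fix e assume "e \<in> nsets V 2 \<union> (\<lambda>u. {v, u}) ` V"
  then show "e \<in> nsets (insert v V) 2"
    using assms by (auto simp: nsets_def card_insert_if)
qed

lemma pair_sum_insert:
  assumes "finite V" "v \<notin> V"
  shows "pair_sum f (insert v V) = pair_sum f V + (\<Sum>u\<in>V. f {v, u})"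
proof -
  have "inj_on (\<lambda>u. {v, u}) V"
    by (auto simp: inj_on_def doubleton_eq_iff)
  moreover have "nsets V 2 \<inter> (\<lambda>u. {v, u}) ` V = {}"
    using assms by (auto simp: nsets_def)
  ultimately show ?thesis
    using assms unfolding pair_sum_def nsets_2_insert[OF assms(2)]
    by (subst sum.union_disjoint) (auto simp: finite_imp_finite_nsets sum.reindex)
qed

lemma pair_sum_empty [simp]: "pair_sum f {} = 0"
  unfolding pair_sum_def by (rule sum.neutral) (auto simp: nsets_def)

lemma pair_sum_remove:
  assumes "finite V" "v \<in> V"
  shows "pair_sum f V = pair_sum f (V - {v}) + star_sum f V v"
  using pair_sum_insert[of "V - {v}" v f] assms by (simp add: insert_absorb star_sum_def)

lemma pair_sum_Un:
  assumes "finite A" "finite B" "A \<inter> B = {}"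
  shows "pair_sum f (A \<union> B) = pair_sum f A + pair_sum f B + (\<Sum>v\<in>B. \<Sum>u\<in>A. f {v, u})"
  using assms(2,1,3)
proof (induction B rule: finite_induct)
  case (insert v B)
  then have "pair_sum f (A \<union> insert v B) = pair_sum f (A \<union> B) + (\<Sum>u\<in>A \<union> B. f {v, u})"
    using pair_sum_insert[of "A \<union> B" v f] by simp
  also have "(\<Sum>u\<in>A \<union> B. f {v, u}) = (\<Sum>u\<in>A. f {v, u}) + (\<Sum>u\<in>B. f {v, u})"
    using insert by (intro sum.union_disjoint) auto
  finally show ?case
    using insert by (simp add: pair_sum_insert algebra_simps)
qed simp

lemma sum_star_sum:
  fixes f :: "'a set \<Rightarrow> 'b::comm_semiring_1"
  assumes "finite V"
  shows "(\<Sum>v\<in>V. star_sum f V v) = 2 * pair_sum f V"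
  using assms
proof (induction V rule: finite_induct)
  case (insert v V)
  have star: "star_sum f (insert v V) u = f {v, u} + star_sum f V u" if "u \<in> V" for u
  proof -
    have "insert v V - {u} = insert v (V - {u})" using insert that by auto
    then show ?thesis using insert by (simp add: star_sum_def insert_commute)
  qed
  have "(\<Sum>u\<in>insert v V. star_sum f (insert v V) u) =
      (\<Sum>u\<in>V. f {v, u}) + (\<Sum>u\<in>V. f {v, u} + star_sum f V u)"
    using insert star by (simp add: star_sum_def cong: sum.cong)
  also have "\<dots> = 2 * pair_sum f (insert v V)"
    using insert by (simp add: sum.distrib pair_sum_insert algebra_simps flip: mult_2)
  finally show ?case .
qed simp

text \<open>A pair survives the deletion of every vertex except its own two. This drives the
  averaging over subsets with one vertex fewer.\<close>

lemma sum_pair_sum_remove: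
  fixes f :: "'a set \<Rightarrow> int"
  assumes "finite V"
  shows "(\<Sum>v\<in>V. pair_sum f (V - {v})) = (int (card V) - 2) * pair_sum f V"
proof -
  have "(\<Sum>v\<in>V. pair_sum f (V - {v})) = (\<Sum>v\<in>V. pair_sum f V - star_sum f V v)"
    using assms pair_sum_remove[of V _ f] by (intro sum.cong) auto
  also have "\<dots> = (int (card V) - 2) * pair_sum f V"
    using assms by (simp add: sum_subtractf sum_star_sum algebra_simps)
  finally show ?thesis .
qed

text \<open>Stated over a commutative ring because it evaluates integer multiplicities as well as
  real scores of Turan graphs.\<close>

lemma pair_sum_two_parts:
  fixes p q r :: "'b::comm_ring_1"
  assumes "finite A" "finite B" "A \<inter> B = {}"
    and "\<And>x y. x \<in> A \<Longrightarrow> y \<in> A \<Longrightarrow> x \<noteq> y \<Longrightarrow> f {x, y} = p"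
    and "\<And>x y. x \<in> B \<Longrightarrow> y \<in> B \<Longrightarrow> x \<noteq> y \<Longrightarrow> f {x, y} = q"
    and "\<And>x y. x \<in> A \<Longrightarrow> y \<in> B \<Longrightarrow> f {x, y} = r"
  shows "pair_sum f (A \<union> B) =
    of_nat (card A choose 2) * p + of_nat (card B choose 2) * q + of_nat (card A * card B) * r"
proof -
  have const: "pair_sum f C = of_nat (card C choose 2) * c"
    if "finite C" "\<And>x y. x \<in> C \<Longrightarrow> y \<in> C \<Longrightarrow> x \<noteq> y \<Longrightarrow> f {x, y} = c" for C and c :: 'b
  proof -
    have "pair_sum f C = (\<Sum>e\<in>nsets C 2. c)"
      unfolding pair_sum_def using that by (intro sum.cong) (auto elim!: nsets_2E)
    then show ?thesis using that by (simp add: card_nsets)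
  qed
  have "(\<Sum>v\<in>B. \<Sum>u\<in>A. f {v, u}) = (\<Sum>v\<in>B. \<Sum>u\<in>A. r)"
    using assms(6) by (intro sum.cong refl) (metis insert_commute)
  then show ?thesis
    using pair_sum_Un[OF assms(1-3), of f] const[OF assms(1,4)] const[OF assms(2,5)]
    by (simp add: algebra_simps)
qed

section \<open>Scores of the Turan graphs and numerical inequalities\<close>

definition turan_score :: "real \<Rightarrow> nat \<Rightarrow> nat \<Rightarrow> real" where
  "turan_score l n m = real m * (real n - real m) - l * (real m * (real m - 1) / 2)"

definition max_turan_score :: "real \<Rightarrow> nat \<Rightarrow> real" where
  "max_turan_score l n = Max (turan_score l n ` {..n})"

lemma turan_score_le_max: "m \<le> n \<Longrightarrow> turan_score l n m \<le> max_turan_score l n"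
  unfolding max_turan_score_def by (intro Max_ge) auto

lemma max_turan_score_attained:
  obtains m where "m \<le> n" "max_turan_score l n = turan_score l n m"
proof -
  have "max_turan_score l n \<in> turan_score l n ` {..n}"
    unfolding max_turan_score_def by (intro Max_in) auto
  then show ?thesis using that by auto
qed

text \<open>A new vertex gains \<open>m\<close> in the part scoring \<open>0\<close> inside, and
  \<open>n - m * (1 + l)\<close> in the part of size \<open>m\<close> whose inner pairs score
  \<open>-l\<close>.\<close>

lemma max_turan_score_Suc:
  assumes "m \<le> n" "max_turan_score l n = turan_score l n m"
    and "d \<le> real m \<or> d \<le> real n - real m * (1 + l)"
  shows "max_turan_score l n + d \<le> max_turan_score l (Suc n)"
proof -
  have "turan_score l (Suc n) m = turan_score l n m + real m"
    "turan_score l (Suc n) (Suc m) = turan_score l n m + real n - real m * (1 + l)"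
    by (simp_all add: turan_score_def field_simps)
  then show ?thesis
    using assms turan_score_le_max[of m "Suc n" l] turan_score_le_max[of "Suc m" "Suc n" l] by auto
qed

text \<open>Putting all \<open>c\<close> new vertices into the part scoring \<open>0\<close> gains
  \<open>m * c\<close>. If \<open>m = 0\<close>, the old optimum is \<open>0\<close>, while a single
  vertex in the penalised part scores \<open>n + c - 1\<close> in the larger graph.\<close>

lemma max_turan_score_add:
  assumes "1 \<le> n" "1 \<le> c"
  shows "max_turan_score l n + real c \<le> max_turan_score l (n + c)"
proof -
  obtain m where m: "m \<le> n" "max_turan_score l n = turan_score l n m"
    by (rule max_turan_score_attained)
  show ?thesis
  proof (cases "m = 0")
    case True
    then have "max_turan_score l n = 0" using m by (simp add: turan_score_def)
    then show ?thesis
      using turan_score_le_max[of 1 "n + c" l] assms by (simp add: turan_score_def)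
  next
    case False
    then have "real c \<le> real m * real c"
      using mult_right_mono[of 1 "real m" "real c"] by simp
    then show ?thesis
      using m turan_score_le_max[of m "n + c" l] by (simp add: turan_score_def algebra_simps)
  qed
qed


text \<open>Here \<open>n\<close> counts all vertices, \<open>D\<close> is the maximum
  \<open>H\<close>-degree, and \<open>u\<close> is the \<open>H\<close>-degree of a vertex lying in
  at least \<open>(D - 1) div 2\<close> negative pairs.\<close>

lemma no_claw_degree_arith:
  fixes l d :: real and n m u D :: nat
  assumes l: "1 \<le> l" "l \<le> 2" and n: "7 \<le> n" "2 * u \<le> n" and D: "3 \<le> D" "u \<le> D"
    and exc: "\<not> (n = 8 \<and> u = 4)"
    and d: "d \<le> real u - l * real ((D - 1) div 2)"
  shows "d \<le> real m \<or> d \<le> real n - 1 - real m * (1 + l)"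
proof (rule ccontr)
  assume "\<not> ?thesis"
  then have m: "real m < d" "real n - 1 - real m * (1 + l) < d" by auto
  define k where "k = (D - 1) div 2"
  have uk: "u \<le> 2 * k + 2" using D unfolding k_def by linarith
  have dk: "d \<le> real u - l * real k" using d by (simp add: k_def)
  \<comment> \<open>Weighting the first failed bound by \<open>1 + l\<close> cancels
    \<open>m\<close>. The resulting inequality \<open>main\<close> refutes all cases except two,
    \<open>n = 9\<close> and \<open>n = 12\<close>.\<close>
  have "(1 + l) * real m < (1 + l) * d" using m l by simp
  then have "real n - 1 < (2 + l) * d" using m by (simp add: algebra_simps)
  also have "\<dots> \<le> (2 + l) * (real u - l * real k)"
    using dk l by (intro mult_left_mono) auto
  finally have main: "real n - 1 < (2 + l) * (real u - l * real k)" .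
  have ll: "l \<le> l * l" using l by simp
  have k1: "1 \<le> k" using D unfolding k_def by linarith
  consider "k = 1" | "k = 2" | "3 \<le> k" using k1 by linarith
  then show False
  proof cases
    case 1
    consider "u \<le> 3" | "u = 4" "n = 9" | "u = 4" "10 \<le> n" using uk 1 n exc by linarith
    then show False
    proof cases
      case 1
      then have "(2 + l) * (real u - l * real k) \<le> (2 + l) * (3 - l)"
        using \<open>k = 1\<close> l by (intro mult_left_mono) auto
      then show False using main n ll by (simp add: algebra_simps)
    next
      case 2
      \<comment> \<open>For \<open>n = 9\<close> the inequality \<open>main\<close> can hold, so the
        integrality of \<open>m\<close> has to be used; likewise for \<open>n = 12\<close>
        below.\<close>
      then have "real m < 3" using m dk \<open>k = 1\<close> l by simp
      then have "m \<in> {0, 1, 2}" by auto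
      then show False using m dk 2 \<open>k = 1\<close> l by (auto simp: algebra_simps)
    next
      case 3
      have "0 \<le> (l - 1) * (l - 1)" by simp
      then show False using main 3 \<open>k = 1\<close> l by (simp add: algebra_simps)
    qed
  next
    case 2
    consider "u \<le> 5" | "u = 6" "n = 12" | "u = 6" "13 \<le> n" using uk 2 n by linarith
    then show False
    proof cases
      case 1
      have "l * real u \<le> l * 5" using 1 l by (intro mult_left_mono) auto
      moreover have "(2 + l) * (real u - l * 2) = 2 * real u + l * real u - 4 * l - 2 * (l * l)"
        by (simp add: algebra_simps)
      moreover have "2 * real u \<le> real n" using n(2) by linarith
      moreover have "real n - 1 < (2 + l) * (real u - l * 2)" using main \<open>k = 2\<close> by simp
      ultimately show False using l(1) ll by linarith
    next
      case 2
      then have "real m < 4" using m dk \<open>k = 2\<close> l by simp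
      then have "m \<in> {0, 1, 2, 3}" by auto
      then show False using m dk 2 \<open>k = 2\<close> l by (auto simp: algebra_simps)
    next
      case 3
      then show False using main \<open>k = 2\<close> l ll by (simp add: algebra_simps)
    qed
  next
    case 3
    have "l * real u \<le> l * (2 * real k + 2)" using uk l by (intro mult_left_mono) auto
    moreover have "3 * l \<le> l * l * real k"
      using mult_mono[of l "l * l" 3 "real k"] 3 l ll by simp
    moreover have "(2 + l) * (real u - l * real k) =
        2 * real u + l * real u - 2 * (l * real k) - l * l * real k"
      by (simp add: algebra_simps)
    moreover have "l * (2 * real k + 2) = 2 * (l * real k) + 2 * l" by (simp add: algebra_simps)
    moreover have "2 * real u \<le> real n" using n(2) by linarith
    ultimately show False using main l(1) by linarith
  qed
qed

section \<open>Integer excesses \<open>t\<close>, the scores \<open>s\<close> below them, and sparse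
  sets\<close>

locale edge_scores =
  fixes l :: real and t :: "'a set \<Rightarrow> int" and s :: "'a set \<Rightarrow> real"
  assumes l_ge_1: "1 \<le> l" and l_le_2: "l \<le> 2"
    and s_le_t: "s e \<le> t e"
    and s_le_neg: "t e < 0 \<Longrightarrow> s e \<le> t e + 1 - l"
begin

definition sparse :: "'a set \<Rightarrow> bool" where
  "sparse V \<longleftrightarrow> finite V \<and> (\<forall>X\<in>nsets V 4. pair_sum t X \<le> 3)"

lemma sparse_subset: "sparse V \<Longrightarrow> W \<subseteq> V \<Longrightarrow> sparse W"
  unfolding sparse_def using nsets_mono[of W V 4] finite_subset by blast

lemma pair_sum_s_le_t: "pair_sum s V \<le> real_of_int (pair_sum t V)"
  unfolding pair_sum_def of_int_sum by (intro sum_mono s_le_t)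

lemma sparse_card_4: "sparse V \<Longrightarrow> card V = 4 \<Longrightarrow> pair_sum t V \<le> 3"
  by (auto simp: sparse_def nsets_def)

text \<open>Averaging over the 4-subsets: three times the sum is at most
  \<open>5 * 3\<close>.\<close>

lemma sparse_card_5:
  assumes "sparse V" "card V = 5"
  shows "pair_sum t V \<le> 5"
proof -
  have fin: "finite V" using assms by (simp add: sparse_def)
  have "(\<Sum>v\<in>V. pair_sum t (V - {v})) \<le> of_nat (card V) * 3"
    using assms fin by (intro sum_bounded_above sparse_card_4 sparse_subset[OF assms(1)]) auto
  then show ?thesis using assms(2) by (simp add: sum_pair_sum_remove[OF fin])
qed

text \<open>Averaging over the 5-subsets: four times the sum is at most \<open>6 * 5\<close>, and
  the sum is an integer.\<close>

lemma sparse_card_6: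
  assumes "sparse V" "card V = 6"
  shows "pair_sum t V \<le> 7"
proof -
  have fin: "finite V" using assms by (simp add: sparse_def)
  have "(\<Sum>v\<in>V. pair_sum t (V - {v})) \<le> of_nat (card V) * 5"
    using assms fin by (intro sum_bounded_above sparse_card_5 sparse_subset[OF assms(1)]) auto
  then show ?thesis using assms(2) by (simp add: sum_pair_sum_remove[OF fin])
qed

text \<open>If \<open>T\<close> exceeds \<open>c\<close> by \<open>j\<close>, every outside vertex
  sends at most \<open>-j\<close> into \<open>T\<close>, so a single outside vertex already cancels
  the surplus.\<close>

lemma pair_sum_remove_dense:
  assumes "finite V" "T \<subset> V" and c: "c \<le> pair_sum t T"
    and ins: "\<And>v. v \<in> V - T \<Longrightarrow> pair_sum t (insert v T) \<le> c"
  shows "pair_sum s V \<le> real_of_int c + pair_sum s (V - T)"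
proof -
  define j where "j = pair_sum t T - c"
  have finT: "finite T" using assms finite_subset by blast
  have out: "(\<Sum>u\<in>T. s {v, u}) \<le> - real_of_int j" if v: "v \<in> V - T" for v
  proof -
    have "(\<Sum>u\<in>T. s {v, u}) \<le> real_of_int (\<Sum>u\<in>T. t {v, u})"
      unfolding of_int_sum by (intro sum_mono s_le_t)
    also have "(\<Sum>u\<in>T. t {v, u}) \<le> - j"
      using ins[OF v] pair_sum_insert[of T v t] finT v by (simp add: j_def)
    finally show ?thesis by simp
  qed
  have "(\<Sum>v\<in>V - T. \<Sum>u\<in>T. s {v, u}) \<le> of_nat (card (V - T)) * - real_of_int j"
    using out by (intro sum_bounded_above) auto
  moreover have "1 \<le> card (V - T)"
    using assms finT by (metis One_nat_def Suc_leI card_gt_0_iff finite_Diff psubset_imp_ex_mem empty_iff)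
  then have "1 * real_of_int j \<le> real (card (V - T)) * real_of_int j"
    using c by (intro mult_right_mono) (auto simp: j_def)
  moreover have "pair_sum s V = pair_sum s T + pair_sum s (V - T) + (\<Sum>v\<in>V - T. \<Sum>u\<in>T. s {v, u})"
    using pair_sum_Un[of T "V - T" s] assms finT by (simp add: Un_absorb1 psubset_imp_subset)
  moreover have "pair_sum s T \<le> real_of_int c + real_of_int j"
    using pair_sum_s_le_t[of T] by (simp add: j_def)
  ultimately show ?thesis by simp
qed

text \<open>Split \<open>V\<close> into \<open>T\<close> and its complement. Each vertex of one half
  together with the other half is a 4-set, which bounds the cross sum in two ways. Twice the first
  bound plus the second gives \<open>3 * pair_sum t V \<le> 27 - 3 * pair_sum t T\<close>.\<close>

lemma sparse_card_6_triple:
  assumes V: "sparse V" "card V = 6" and T: "T \<in> nsets V 3" "3 \<le> pair_sum t T"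
  shows "pair_sum t V \<le> 6"
proof -
  have fin: "finite V" using V by (simp add: sparse_def)
  have T': "T \<subseteq> V" "finite T" "card T = 3" using T by (auto simp: nsets_def)
  have card: "card (V - T) = 3" using T' V fin by (simp add: card_Diff_subset)
  have bound: "pair_sum t V \<le> 9 - 2 * pair_sum t A + pair_sum t B"
    if AB: "A \<union> B = V" "A \<inter> B = {}" "card A = 3" "card B = 3" for A B
  proof -
    have finAB: "finite A" "finite B" using AB fin by auto
    have "(\<Sum>u\<in>A. t {v, u}) \<le> 3 - pair_sum t A" if "v \<in> B" for v
    proof -
      have v: "v \<notin> A" using AB that by auto
      have "pair_sum t (insert v A) \<le> 3"
        using AB finAB that v by (intro sparse_card_4 sparse_subset[OF V(1)]) auto
      then show ?thesis using pair_sum_insert[OF finAB(1) v, of t] by simp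
    qed
    then have "(\<Sum>v\<in>B. \<Sum>u\<in>A. t {v, u}) \<le> of_nat (card B) * (3 - pair_sum t A)"
      by (intro sum_bounded_above)
    then show ?thesis using AB pair_sum_Un[OF finAB AB(2), of t] by simp
  qed
  have "pair_sum t V \<le> 9 - 2 * pair_sum t T + pair_sum t (V - T)"
    "pair_sum t V \<le> 9 - 2 * pair_sum t (V - T) + pair_sum t T"
    using T' card by (auto intro!: bound)
  then show ?thesis using T(2) by linarith
qed

section \<open>Neighbourhoods in the graph \<open>H\<close>, negative pairs, and tame sets\<close>

definition nbrs :: "'a set \<Rightarrow> 'a \<Rightarrow> 'a set" where
  "nbrs V v = {u \<in> V - {v}. t {v, u} = 1}"

definition negs :: "'a set \<Rightarrow> 'a \<Rightarrow> 'a set" where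
  "negs V v = {u \<in> V - {v}. t {v, u} < 0}"

text \<open>The last clause concerns a 4-cycle \<open>x u y v\<close> of \<open>H\<close>: if the
  diagonal \<open>x y\<close> is not negative, the diagonal \<open>u v\<close> is.\<close>

definition tame :: "'a set \<Rightarrow> bool" where
  "tame V \<longleftrightarrow> finite V \<and> (\<forall>e\<in>nsets V 2. t e \<le> 1) \<and>
     (\<forall>x\<in>V. \<forall>y\<in>nbrs V x. nbrs V x \<inter> nbrs V y = {}) \<and>
     (\<forall>x\<in>V. \<forall>y\<in>V - {x}. y \<notin> negs V x \<longrightarrow>
       (\<forall>u\<in>nbrs V x \<inter> nbrs V y. \<forall>v\<in>nbrs V x \<inter> nbrs V y. u \<noteq> v \<longrightarrow> v \<in> negs V u))"

lemma nbrs_sym: "u \<in> nbrs V v \<Longrightarrow> v \<in> V \<Longrightarrow> v \<in> nbrs V u"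
  by (auto simp: nbrs_def insert_commute)

lemma negs_sym: "u \<in> negs V v \<Longrightarrow> v \<in> V \<Longrightarrow> v \<in> negs V u"
  by (auto simp: negs_def insert_commute)

lemma nbrs_subset: "nbrs V v \<subseteq> V - {v}" and negs_subset: "negs V v \<subseteq> V - {v}"
  by (auto simp: nbrs_def negs_def)

lemma negs_irrefl [simp]: "v \<notin> negs V v"
  by (simp add: negs_def)

lemma tame_finite: "tame V \<Longrightarrow> finite V"
  and tame_le_1: "tame V \<Longrightarrow> e \<in> nsets V 2 \<Longrightarrow> t e \<le> 1"
  and tame_triangle: "tame V \<Longrightarrow> x \<in> V \<Longrightarrow> y \<in> nbrs V x \<Longrightarrow> z \<in> nbrs V x \<Longrightarrow> z \<notin> nbrs V y"
  and tame_C4: "tame V \<Longrightarrow> x \<in> V \<Longrightarrow> y \<in> V \<Longrightarrow> x \<noteq> y \<Longrightarrow> y \<notin> negs V x \<Longrightarrow>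
    u \<in> nbrs V x \<Longrightarrow> u \<in> nbrs V y \<Longrightarrow> v \<in> nbrs V x \<Longrightarrow> v \<in> nbrs V y \<Longrightarrow> u \<noteq> v \<Longrightarrow> v \<in> negs V u"
  unfolding tame_def by blast+

lemma finite_nbrs: "tame V \<Longrightarrow> finite (nbrs V v)" and finite_negs: "tame V \<Longrightarrow> finite (negs V v)"
  by (auto simp: nbrs_def negs_def tame_finite)

lemma s_cases:
  assumes "tame V" "x \<in> V" "u \<in> V" "u \<noteq> x"
  shows "s {x, u} \<le> of_bool (u \<in> nbrs V x) - l * of_bool (u \<in> negs V x)"
proof -
  have "t {x, u} \<le> 1" using assms by (intro tame_le_1) (auto simp: doubleton_in_nsets)
  then show ?thesis
    using assms s_le_t[of "{x, u}"] s_le_neg[of "{x, u}"] by (auto simp: nbrs_def negs_def of_bool_def)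
qed

lemma star_sum_le:
  assumes "tame V" "v \<in> V"
  shows "star_sum s V v \<le> real (card (nbrs V v)) - l * real (card (negs V v))"
proof -
  have "star_sum s V v \<le> (\<Sum>u\<in>V - {v}. of_bool (u \<in> nbrs V v) - l * of_bool (u \<in> negs V v))"
    unfolding star_sum_def using s_cases assms by (intro sum_mono) auto
  also have "\<dots> = real (card ((V - {v}) \<inter> nbrs V v)) - l * real (card ((V - {v}) \<inter> negs V v))"
    using tame_finite[OF assms(1)] by (simp add: sum_subtractf sum_of_bool_eq flip: sum_distrib_left)
  finally show ?thesis by (simp add: Int_absorb1 nbrs_subset negs_subset)
qed

text \<open>A triangle of \<open>H\<close> would be a triple of sum \<open>3\<close>. The sides of a
  4-cycle sum to \<open>4\<close>, so its diagonals sum to at most \<open>-1\<close>.\<close>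

lemma sparse_tame:
  assumes V: "sparse V" and e: "\<And>e. e \<in> nsets V 2 \<Longrightarrow> t e \<le> 1"
    and T: "\<And>T. T \<in> nsets V 3 \<Longrightarrow> pair_sum t T \<le> 2"
  shows "tame V"
  unfolding tame_def
proof (intro conjI ballI impI)
  show "finite V" using V by (simp add: sparse_def)
  show "t e \<le> 1" if "e \<in> nsets V 2" for e using e that .
next
  fix x y assume xy: "x \<in> V" "y \<in> nbrs V x"
  show "nbrs V x \<inter> nbrs V y = {}"
  proof (rule ccontr)
    assume "nbrs V x \<inter> nbrs V y \<noteq> {}"
    then obtain z where z: "z \<in> nbrs V x" "z \<in> nbrs V y" by auto
    then have "x \<noteq> y" "x \<noteq> z" "y \<noteq> z" "{x, y, z} \<in> nsets V 3"
      using xy by (auto simp: nbrs_def nsets_def)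
    then show False
      using T[of "{x, y, z}"] xy z by (simp add: pair_sum_insert nbrs_def)
  qed
next
  fix x y u v
  assume *: "x \<in> V" "y \<in> V - {x}" "y \<notin> negs V x" "u \<in> nbrs V x \<inter> nbrs V y"
    "v \<in> nbrs V x \<inter> nbrs V y" "u \<noteq> v"
  then have d: "x \<noteq> y" "x \<noteq> u" "x \<noteq> v" "y \<noteq> u" "y \<noteq> v" "{x, y, u, v} \<in> nsets V 4"
    by (auto simp: nbrs_def nsets_def)
  then have "pair_sum t {x, y, u, v} \<le> 3" using V by (simp add: sparse_def)
  then show "v \<in> negs V u"
    using * d by (auto simp: pair_sum_insert nbrs_def negs_def)
qed

section \<open>Claws and the deletion of a vertex of small score degree\<close>

definition claw :: "'a set \<Rightarrow> 'a \<Rightarrow> 'a set \<Rightarrow> bool" where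
  "claw V x B \<longleftrightarrow> B \<subseteq> nbrs V x \<and> card B = 3 \<and> (\<forall>b\<in>B. B \<inter> negs V b = {})"

text \<open>Double counting distributes the left side over the vertices \<open>v\<close>:
  \<open>x\<close> receives \<open>1 + l\<close>, every other vertex at most \<open>1\<close>. An
  \<open>H\<close>-neighbour of \<open>x\<close> has no neighbour in \<open>B\<close>, as
  \<open>H\<close> is triangle-free; a negative partner of \<open>x\<close> loses \<open>l\<close>
  and regains at most \<open>1 + l\<close>; any other vertex has at most one neighbour in
  \<open>B\<close>.\<close>

lemma claw_degree_bound:
  assumes V: "tame V" "x \<in> V" and claw: "claw V x B"
  shows "star_sum s V x + (1 + l) / 3 * (\<Sum>b\<in>B. real (card (nbrs V b))) \<le> real (card V) + l"
proof -
  have B: "B \<subseteq> nbrs V x" "card B = 3" "finite B" and BV: "B \<subseteq> V"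
    using claw nbrs_subset[of V x] by (auto simp: claw_def intro: card_ge_0_finite)
  have fin: "finite V" using V tame_finite by blast
  have "(\<Sum>b\<in>B. real (card (nbrs V b))) = (\<Sum>b\<in>B. \<Sum>v\<in>V. of_bool (v \<in> nbrs V b))"
    using fin nbrs_subset[of V] by (intro sum.cong) (auto simp: sum_of_bool_eq Int_absorb1 subset_Diff_insert)
  also have "\<dots> = (\<Sum>v\<in>V. \<Sum>b\<in>B. of_bool (v \<in> nbrs V b))" by (rule sum.swap)
  also have "\<dots> = (\<Sum>v\<in>V. real (card (B \<inter> nbrs V v)))"
  proof (rule sum.cong)
    fix v assume "v \<in> V"
    then have "B \<inter> {b. v \<in> nbrs V b} = B \<inter> nbrs V v" using BV nbrs_sym by blast
    then show "(\<Sum>b\<in>B. of_bool (v \<in> nbrs V b)) = real (card (B \<inter> nbrs V v))"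
      using B by (simp add: sum_of_bool_eq)
  qed simp
  also have "\<dots> = 3 + (\<Sum>v\<in>V - {x}. real (card (B \<inter> nbrs V v)))"
    using B V fin by (simp add: sum.remove[of V x] Int_absorb2)
  finally have count: "(\<Sum>b\<in>B. real (card (nbrs V b))) = 3 + (\<Sum>v\<in>V - {x}. real (card (B \<inter> nbrs V v)))" .
  have "star_sum s V x + (1 + l) / 3 * (\<Sum>b\<in>B. real (card (nbrs V b))) =
      (1 + l) + (\<Sum>v\<in>V - {x}. s {x, v} + (1 + l) / 3 * real (card (B \<inter> nbrs V v)))"
    unfolding count star_sum_def sum.distrib sum_distrib_left[symmetric] by (simp add: algebra_simps)
  also have "(\<Sum>v\<in>V - {x}. s {x, v} + (1 + l) / 3 * real (card (B \<inter> nbrs V v))) \<le> of_nat (card (V - {x})) * 1"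
  proof (rule sum_bounded_above)
    fix v assume v: "v \<in> V - {x}"
    have s: "s {x, v} \<le> of_bool (v \<in> nbrs V x) - l * of_bool (v \<in> negs V x)"
      using v V s_cases by auto
    have disj: "v \<in> nbrs V x \<Longrightarrow> v \<notin> negs V x" by (auto simp: nbrs_def negs_def)
    have c3: "card (B \<inter> nbrs V v) \<le> 3"
      using B card_mono[of B "B \<inter> nbrs V v"] by auto
    consider "v \<in> nbrs V x" | "v \<in> negs V x" | "v \<notin> nbrs V x" "v \<notin> negs V x" by blast
    then show "s {x, v} + (1 + l) / 3 * real (card (B \<inter> nbrs V v)) \<le> 1"
    proof cases
      case 1
      then have "B \<inter> nbrs V v = {}" using tame_triangle[OF V] B by blast
      then show ?thesis using s 1 disj by simp
    next
      case 2
      have "(1 + l) / 3 * real (card (B \<inter> nbrs V v)) \<le> (1 + l) / 3 * 3"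
        using c3 l_ge_1 by (intro mult_left_mono) auto
      also have "\<dots> = 1 + l" by simp
      finally have "(1 + l) / 3 * real (card (B \<inter> nbrs V v)) \<le> 1 + l" .
      moreover have "v \<notin> nbrs V x" using 2 disj by blast
      then have "s {x, v} \<le> - l" using s 2 by simp
      ultimately show ?thesis by linarith
    next
      case 3
      \<comment> \<open>Two neighbours \<open>b\<close>, \<open>c\<close> would close a 4-cycle
        \<open>x b v c\<close> whose diagonal \<open>x v\<close> is not negative, so
        \<open>b c\<close> would be a negative pair inside the claw.\<close>
      have "\<exists>b. B \<inter> nbrs V v \<subseteq> {b}"
      proof (rule ccontr)
        assume "\<not> ?thesis"
        then obtain b c where bc: "b \<in> B \<inter> nbrs V v" "c \<in> B \<inter> nbrs V v" "b \<noteq> c" by blast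
        then have "c \<in> negs V b" using tame_C4[OF V, of v b c] v 3 B by blast
        then show False using bc claw by (auto simp: claw_def)
      qed
      then have "card (B \<inter> nbrs V v) \<le> 1"
        by (metis card.empty card_mono finite.emptyI finite.insertI is_singletonI is_singleton_altdef)
      then have "(1 + l) / 3 * real (card (B \<inter> nbrs V v)) \<le> (1 + l) / 3 * 1"
        using l_ge_1 by (intro mult_left_mono) auto
      then show ?thesis using s 3 l_le_2 by simp
    qed
  qed
  finally show ?thesis using card_Suc_Diff1[OF fin V(2)] by simp
qed

text \<open>Without claws, the non-negative pairs inside an \<open>H\<close>-neighbourhood form a
  triangle-free graph.\<close>

lemma no_claw_negs:
  assumes V: "tame V" "x \<in> V" and no: "\<And>B. \<not> claw V x B" and y: "y \<in> nbrs V x"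
    and z: "z \<in> nbrs V x - {y} - negs V y"
  shows "nbrs V x - {y} - negs V y - {z} \<subseteq> negs V z"
proof
  fix u assume u: "u \<in> nbrs V x - {y} - negs V y - {z}"
  show "u \<in> negs V z"
  proof (rule ccontr)
    assume "u \<notin> negs V z"
    then have "claw V x {y, z, u}"
      using u y z negs_sym[of _ V] nbrs_subset[of V x] negs_subset[of V]
      by (auto simp: claw_def)
    then show False using no by blast
  qed
qed

text \<open>If \<open>y\<close> has fewer than \<open>k\<close> negative partners, at least
  \<open>D - k\<close> neighbours of \<open>x\<close> are non-negative to \<open>y\<close>, where
  \<open>D\<close> is the \<open>H\<close>-degree of \<open>x\<close>. Any one of them is negative
  to all the others, hence to at least \<open>D - k - 1 \<ge> k\<close> vertices.\<close>

lemma no_claw_many_negs: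
  assumes V: "tame V" "x \<in> V" and no: "\<And>B. \<not> claw V x B" and ne: "nbrs V x \<noteq> {}"
  obtains y where "y \<in> nbrs V x" "(card (nbrs V x) - 1) div 2 \<le> card (negs V y)"
proof -
  obtain y where y: "y \<in> nbrs V x" using ne by blast
  let ?k = "(card (nbrs V x) - 1) div 2"
  let ?R = "nbrs V x - {y} - negs V y"
  have fin: "finite (nbrs V x)" "\<And>v. finite (negs V v)" using V finite_nbrs finite_negs by auto
  have R: "card (nbrs V x) - 1 - card (negs V y) \<le> card ?R"
    using y fin diff_card_le_card_Diff[of "negs V y" "nbrs V x - {y}"] by simp
  show ?thesis
  proof (cases "?k \<le> card (negs V y)")
    case True
    then show ?thesis using that y by blast
  next
    case False
    then have "?R \<noteq> {}" using R by (intro notI) simp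
    then obtain z where z: "z \<in> ?R" by blast
    have "card (?R - {z}) \<le> card (negs V z)"
      using no_claw_negs[OF V no y z] fin by (intro card_mono) auto
    then have "card ?R - 1 \<le> card (negs V z)" using z fin by simp
    then have "?k \<le> card (negs V z)" using R False by linarith
    then show ?thesis using that z by blast
  qed
qed

text \<open>The only case in which the degree estimate \<open>no_claw_degree_arith\<close> is not good enough:
  here \<open>H\<close> would have to be \<open>K\<^sub>4\<^sub>,\<^sub>4\<close>.\<close>

lemma no_claw_card_8:
  assumes V: "tame V" "card V = 8" "x \<in> V" and no: "\<And>B. \<not> claw V x B"
    and x: "card (nbrs V x) = 4" and max: "\<And>v. v \<in> V \<Longrightarrow> card (nbrs V v) \<le> 4"
  shows "\<exists>v\<in>V. star_sum s V v \<le> 2"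
proof (rule ccontr)
  assume "\<not> ?thesis"
  then have big: "2 < star_sum s V v" if "v \<in> V" for v using that by auto
  have fin: "finite V" "finite (nbrs V v)" "finite (negs V v)" for v
    using V(1) tame_finite finite_nbrs finite_negs by auto
  have sub: "nbrs V x \<subseteq> V" using nbrs_subset[of V x] by auto
  \<comment> \<open>As \<open>H\<close>-degrees are at most \<open>4\<close>, a vertex lies in at
    most one negative pair, and if it lies in one, its \<open>H\<close>-degree is
    \<open>4\<close>.\<close>
  have deg: "card (negs V v) + 2 < card (nbrs V v)" if "v \<in> V" for v
  proof -
    have "real (card (negs V v)) \<le> l * real (card (negs V v))"
      using l_ge_1 mult_right_mono[of 1 l "real (card (negs V v))"] by simp
    then have "real (card (negs V v)) + 2 < real (card (nbrs V v))"
      using star_sum_le[OF V(1) that] big[OF that] by linarith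
    then show ?thesis by linarith
  qed
  have full: "nbrs V y = V - nbrs V x" if y: "y \<in> nbrs V x" for y
  proof -
    \<comment> \<open>Otherwise any other neighbour \<open>z\<close> of \<open>x\<close> would be
      negative to the remaining two.\<close>
    have "negs V y \<noteq> {}"
    proof
      assume e: "negs V y = {}"
      have "card (nbrs V x - {y}) = 3" using y x fin by simp
      then obtain z where z: "z \<in> nbrs V x - {y}"
        by (metis card.empty ex_in_conv zero_neq_numeral)
      have "nbrs V x - {y} - {z} \<subseteq> negs V z"
        using no_claw_negs[OF V(1,3) no y, of z] z e by simp
      then have "card (nbrs V x - {y} - {z}) \<le> card (negs V z)" using fin by (intro card_mono)
      then have "2 \<le> card (negs V z)" using z y x fin by simp
      then show False using deg[of z] max[of z] z sub by force
    qed
    then have "1 \<le> card (negs V y)" using fin by (simp add: Suc_le_eq card_gt_0_iff)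
    then have "4 \<le> card (nbrs V y)" using deg[of y] sub y by force
    moreover have "card (V - nbrs V x) = 4" using V x sub fin by (simp add: card_Diff_subset)
    moreover have "nbrs V y \<subseteq> V - nbrs V x"
      using tame_triangle[OF V(1,3) y] nbrs_subset[of V y] by blast
    ultimately show ?thesis using fin by (intro card_seteq) auto
  qed
  obtain y where y: "y \<in> nbrs V x" using x by fastforce
  have "card (negs V y) \<le> 1" using deg[of y] max[of y] y sub by force
  then have "2 \<le> card (nbrs V x - {y} - negs V y)"
    using diff_card_le_card_Diff[of "negs V y" "nbrs V x - {y}"] fin x y by simp
  then obtain z where z: "z \<in> nbrs V x - {y} - negs V y"
    by (metis card.empty ex_in_conv not_numeral_le_zero)
  have xin: "x \<in> V - nbrs V x" using V nbrs_subset[of V x] by auto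
  \<comment> \<open>Every \<open>v\<close> on the side of \<open>x\<close> forms a 4-cycle
    \<open>y x z v\<close> with non-negative diagonal \<open>y z\<close>, which makes
    \<open>x v\<close> negative. Three negative pairs at \<open>x\<close> are too many.\<close>
  have "V - nbrs V x - {x} \<subseteq> negs V x"
  proof
    fix v assume v: "v \<in> V - nbrs V x - {x}"
    show "v \<in> negs V x"
      using tame_C4[OF V(1), of y z x v] full[OF y] full[of z] y z v xin sub by auto
  qed
  then have "card (V - nbrs V x - {x}) \<le> card (negs V x)" using fin by (intro card_mono)
  moreover have "card (V - nbrs V x - {x}) = 3"
    using V x sub fin xin by (simp add: card_Diff_subset)
  ultimately show False using deg[OF V(3)] x by simp
qed

text \<open>By \<open>max_turan_score_Suc\<close> it is enough to find one vertex whose score degree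
  is at most one of the two gains for the optimal \<open>m\<close>. With a claw this is
  \<open>x\<close> or a member of \<open>B\<close>; without one, it is a neighbour of a vertex of
  maximum \<open>H\<close>-degree, unless that maximum is at most \<open>2\<close> or the
  exceptional 8-vertex case occurs.\<close>

lemma tame_step:
  assumes V: "tame V" "card V = Suc n" "6 \<le> n"
    and IH: "\<And>v. v \<in> V \<Longrightarrow> pair_sum s (V - {v}) \<le> max_turan_score l n"
  shows "pair_sum s V \<le> max_turan_score l (Suc n)"
proof -
  have fin: "finite V" "finite (nbrs V v)" for v using V(1) tame_finite finite_nbrs by auto
  obtain m where m: "m \<le> n" "max_turan_score l n = turan_score l n m"
    by (rule max_turan_score_attained)
  have suff: ?thesis
    if "v \<in> V" "star_sum s V v \<le> real m \<or> star_sum s V v \<le> real n - real m * (1 + l)" for v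
    using max_turan_score_Suc[OF m that(2)] IH[OF that(1)] pair_sum_remove[OF fin(1) that(1), of s]
    by linarith
  have suff2: ?thesis if v: "v \<in> V" "star_sum s V v \<le> 2" for v
  proof (rule suff[OF v(1)])
    \<comment> \<open>For \<open>m \<le> 1\<close> the second gain is at least \<open>n - 3\<close>,
      hence at least \<open>3\<close>.\<close>
    have "2 \<le> m \<or> m = 0 \<or> m = 1" by linarith
    then show "star_sum s V v \<le> real m \<or> star_sum s V v \<le> real n - real m * (1 + l)"
      using v(2) V(3) l_le_2 by auto
  qed
  show ?thesis
  proof (cases "\<exists>x\<in>V. \<exists>B. claw V x B")
    case True
    then obtain x B where x: "x \<in> V" "claw V x B" by blast
    then have B: "B \<subseteq> V" "card B = 3" using nbrs_subset[of V x] by (auto simp: claw_def)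
    show ?thesis
    proof (cases "\<exists>b\<in>B. card (nbrs V b) \<le> m")
      case True
      then obtain b where b: "b \<in> B" "card (nbrs V b) \<le> m" by blast
      have "0 \<le> l * real (card (negs V b))" using l_ge_1 by simp
      then have "star_sum s V b \<le> real m" using star_sum_le[OF V(1), of b] b B by force
      then show ?thesis using suff b B by blast
    next
      case False
      \<comment> \<open>All three degrees are at least \<open>m + 1\<close> by integrality. This
        extra unit absorbs the term \<open>1 + l\<close> on the right of
        \<open>claw_degree_bound\<close>, where \<open>card V = n + 1\<close>.\<close>
      then have "of_nat (card B) * (real m + 1) \<le> (\<Sum>b\<in>B. real (card (nbrs V b)))"
        by (intro sum_bounded_below) (force simp: not_le Suc_le_eq)
      then have "(1 + l) / 3 * (3 * (real m + 1)) \<le> (1 + l) / 3 * (\<Sum>b\<in>B. real (card (nbrs V b)))"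
        using B l_ge_1 by (intro mult_left_mono) auto
      moreover have "(1 + l) / 3 * (3 * (real m + 1)) = 1 + l + real m * (1 + l)"
        by (simp add: field_simps)
      ultimately have "star_sum s V x \<le> real n - real m * (1 + l)"
        using claw_degree_bound[OF V(1) x] V(2) by linarith
      then show ?thesis using suff x by blast
    qed
  next
    case False
    then have no: "\<not> claw V x B" if "x \<in> V" for x B using that by blast
    have "Max ((\<lambda>v. card (nbrs V v)) ` V) \<in> (\<lambda>v. card (nbrs V v)) ` V"
      using fin V(2) by (intro Max_in) auto
    then obtain x where x: "x \<in> V" "Max ((\<lambda>v. card (nbrs V v)) ` V) = card (nbrs V x)" by auto
    have max: "card (nbrs V v) \<le> card (nbrs V x)" if "v \<in> V" for v
      using Max_ge[of "(\<lambda>v. card (nbrs V v)) ` V" "card (nbrs V v)"] fin that x by auto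
    show ?thesis
    proof (cases "card (nbrs V x) \<le> 2")
      case True
      have "0 \<le> l * real (card (negs V x))" using l_ge_1 by simp
      then have "star_sum s V x \<le> 2" using star_sum_le[OF V(1) x(1)] True by linarith
      then show ?thesis using suff2 x by blast
    next
      case False
      then have "nbrs V x \<noteq> {}" by auto
      then obtain y where y: "y \<in> nbrs V x" "(card (nbrs V x) - 1) div 2 \<le> card (negs V y)"
        using no_claw_many_negs[OF V(1) x(1) no[OF x(1)]] by blast
      have sub: "nbrs V x \<subseteq> V" and yV: "y \<in> V" using nbrs_subset[of V x] y by auto
      \<comment> \<open>Disjoint neighbourhoods bound the sum of the two degrees by
        \<open>Suc n\<close>. As the degree of \<open>x\<close> is maximal, that of \<open>y\<close>
        is at most half of \<open>Suc n\<close>.\<close>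
      have "nbrs V y \<subseteq> V - nbrs V x"
        using tame_triangle[OF V(1) x(1) y(1)] nbrs_subset[of V y] by blast
      then have "card (nbrs V y) \<le> card (V - nbrs V x)" using fin by (intro card_mono) auto
      also have "\<dots> = Suc n - card (nbrs V x)" using fin sub V by (simp add: card_Diff_subset)
      finally have u: "card (nbrs V y) \<le> Suc n - card (nbrs V x)" .
      have uD: "card (nbrs V y) \<le> card (nbrs V x)" using max yV by blast
      have Dn: "card (nbrs V x) \<le> Suc n" using card_mono[OF fin(1) sub] V by simp
      show ?thesis
      proof (cases "Suc n = 8 \<and> card (nbrs V y) = 4")
        case True
        then have "card (nbrs V x) = 4" using u uD Dn by linarith
        then show ?thesis
          using no_claw_card_8[OF V(1) _ x(1) no[OF x(1)]] V True max suff2 by auto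
      next
        case False
        have "l * real ((card (nbrs V x) - 1) div 2) \<le> l * real (card (negs V y))"
          using y l_ge_1 by (intro mult_left_mono) auto
        then have "star_sum s V y \<le> real (card (nbrs V y)) - l * real ((card (nbrs V x) - 1) div 2)"
          using star_sum_le[OF V(1) yV] by linarith
        then have "star_sum s V y \<le> real m \<or> star_sum s V y \<le> real (Suc n) - 1 - real m * (1 + l)"
          using False u uD Dn V \<open>\<not> card (nbrs V x) \<le> 2\<close>
          by (intro no_claw_degree_arith[OF l_ge_1 l_le_2, of "Suc n" "card (nbrs V y)" "card (nbrs V x)"]) linarith+
        then show ?thesis using suff yV by simp
      qed
    qed
  qed
qed

section \<open>The base case: tame sets of six vertices\<close>

lemma tame_card_6_no_negs:
  assumes V: "tame V" "sparse V" "card V = 6" and nonneg: "\<And>e. e \<in> nsets V 2 \<Longrightarrow> 0 \<le> t e"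
  shows "pair_sum t V \<le> 6"
proof (rule ccontr)
  assume "\<not> ?thesis"
  \<comment> \<open>Now \<open>H\<close> has at least seven edges, no triangle and, for lack of
    negative pairs, no 4-cycle.\<close>
  then have 7: "7 \<le> pair_sum t V" by simp
  have fin: "finite V" "finite (nbrs V v)" for v using V(1) tame_finite finite_nbrs by auto
  have no_negs: "negs V v = {}" if "v \<in> V" for v
  proof -
    have "0 \<le> t {v, u}" if "u \<in> V - {v}" for u
      using \<open>v \<in> V\<close> that by (intro nonneg) (auto simp: doubleton_in_nsets)
    then show ?thesis by (force simp: negs_def)
  qed
  have star: "star_sum t V v = int (card (nbrs V v))" if v: "v \<in> V" for v
  proof -
    have "star_sum t V v = (\<Sum>u\<in>V - {v}. of_bool (t {v, u} = 1))"
      unfolding star_sum_def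
    proof (rule sum.cong)
      fix u assume u: "u \<in> V - {v}"
      have "{v, u} \<in> nsets V 2" using u v by (auto simp: doubleton_in_nsets)
      then have "0 \<le> t {v, u}" "t {v, u} \<le> 1" using nonneg tame_le_1[OF V(1)] by auto
      then show "t {v, u} = of_bool (t {v, u} = 1)" by (cases "t {v, u} = 1") auto
    qed simp
    also have "\<dots> = int (card (nbrs V v))"
      using fin by (simp add: sum_of_bool_eq nbrs_def Int_def)
    finally show ?thesis .
  qed
  have two: "2 \<le> card (nbrs V v)" if v: "v \<in> V" for v
  proof -
    have "pair_sum t (V - {v}) \<le> 5"
      using V fin v by (intro sparse_card_5 sparse_subset[OF V(2)]) auto
    then show ?thesis using pair_sum_remove[OF fin(1) v, of t] star[OF v] 7 by simp
  qed
  \<comment> \<open>The degrees sum to at least \<open>14\<close>, more than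
    \<open>6 * 2\<close>.\<close>
  have "\<exists>x\<in>V. 3 \<le> card (nbrs V x)"
  proof (rule ccontr)
    assume "\<not> ?thesis"
    then have "(\<Sum>v\<in>V. star_sum t V v) \<le> of_nat (card V) * 2"
      using star by (intro sum_bounded_above) fastforce
    then show False using sum_star_sum[OF fin(1), of t] V 7 by simp
  qed
  then obtain x B where x: "x \<in> V" and B: "B \<subseteq> nbrs V x" "card B = 3" "finite B"
    by (metis obtain_subset_with_card_n)
  have "\<exists>u\<in>nbrs V b. u \<noteq> x" if "b \<in> B" for b
  proof (rule ccontr)
    assume "\<not> ?thesis"
    then have "card (nbrs V b) \<le> card {x}" by (intro card_mono) auto
    then show False using two[of b] B that nbrs_subset[of V x] by force
  qed
  then obtain u where u: "u b \<in> nbrs V b" "u b \<noteq> x" if "b \<in> B" for b by metis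
  have BV: "insert x B \<subseteq> V" "x \<notin> B" using B x nbrs_subset[of V x] by auto
  \<comment> \<open>Each member of \<open>B\<close> has a second neighbour, which triangle-freeness
    forces into the two vertices outside \<open>insert x B\<close>. Two members therefore share it
    and close a 4-cycle through \<open>x\<close>.\<close>
  have "u ` B \<subseteq> V - insert x B"
    using u tame_triangle[OF V(1) x] B nbrs_subset[of V] by blast
  then have "card (u ` B) \<le> card (V - insert x B)" using fin by (intro card_mono) auto
  also have "\<dots> = 2" using BV B V by (simp add: card_Diff_subset)
  finally have "\<not> inj_on u B" using B card_image[of u B] by auto
  then obtain b c where bc: "b \<in> B" "c \<in> B" "u b = u c" "b \<noteq> c" by (auto simp: inj_on_def)
  have uV: "u b \<in> V" "b \<in> V" "c \<in> V" using u[OF bc(1)] nbrs_subset[of V] bc BV by auto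
  have "c \<in> negs V b"
    using tame_C4[OF V(1) x uV(1), of b c] u[OF bc(1)] u[OF bc(2)] bc B uV no_negs[OF x]
      nbrs_sym[of "u b" V b] nbrs_sym[of "u c" V c] by auto
  then show False using no_negs uV by simp
qed

text \<open>The bound is \<open>turan_score l 6 2\<close>. A negative pair lowers the score by a
  further \<open>l - 1\<close> below the sum of \<open>t\<close>, which is at most \<open>7\<close>;
  without negative pairs that sum is at most \<open>6\<close>.\<close>

lemma tame_card_6:
  assumes V: "tame V" "sparse V" "card V = 6"
  shows "pair_sum s V \<le> 8 - l"
proof (cases "\<exists>e\<in>nsets V 2. t e < 0")
  case True
  then obtain e where e: "e \<in> nsets V 2" "t e < 0" by blast
  have fin: "finite (nsets V 2)" using tame_finite[OF V(1)] by (rule finite_imp_finite_nsets)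
  have "pair_sum s V = s e + (\<Sum>d\<in>nsets V 2 - {e}. s d)"
    unfolding pair_sum_def using fin e by (rule_tac sum.remove) auto
  also have "\<dots> \<le> (t e + 1 - l) + real_of_int (\<Sum>d\<in>nsets V 2 - {e}. t d)"
    unfolding of_int_sum using e by (intro add_mono s_le_neg sum_mono s_le_t)
  also have "\<dots> = real_of_int (pair_sum t V) + 1 - l"
    unfolding pair_sum_def using fin e by (simp add: sum.remove[of "nsets V 2" e])
  finally show ?thesis using sparse_card_6[OF V(2,3)] by linarith
next
  case False
  then have "pair_sum t V \<le> 6" using V by (intro tame_card_6_no_negs) auto
  then show ?thesis using pair_sum_s_le_t[of V] l_le_2 by linarith
qed

section \<open>The induction on the number of vertices\<close>

theorem sparse_bound:
  assumes "sparse V" "6 \<le> card V"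
  shows "pair_sum s V \<le> max_turan_score l (card V)"
  using assms
proof (induction "card V" arbitrary: V rule: less_induct)
  case less
  let ?n = "card V"
  note V = less.prems
  have fin: "finite V" using V by (simp add: sparse_def)
  \<comment> \<open>The Turan graph with \<open>m = 2\<close>, sufficient in all the small
    cases.\<close>
  have two: "2 * (real ?n - 2) - l \<le> max_turan_score l ?n"
    using turan_score_le_max[of 2 ?n l] V by (simp add: turan_score_def)
  \<comment> \<open>The bound fails for five vertices (take \<open>H\<close> to be a pentagon), so a remainder of four or five
    vertices is treated separately.\<close>
  have remove: "pair_sum s V \<le> max_turan_score l ?n"
    if T: "T \<subseteq> V" "card T = c" "2 \<le> c" "c \<le> 3" "int c \<le> pair_sum t T" "c + 4 \<le> ?n"
      "\<And>v. v \<in> V - T \<Longrightarrow> pair_sum t (insert v T) \<le> int c" for T c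
  proof -
    have card: "card (V - T) = ?n - c" using T fin by (simp add: card_Diff_subset finite_subset)
    have "T \<noteq> V" using T by auto
    then have rem: "pair_sum s V \<le> real c + pair_sum s (V - T)"
      using pair_sum_remove_dense[of V T "int c"] T fin by auto
    have c2: "2 \<le> real c" using T(3) by simp
    have sp: "sparse (V - T)" using V by (auto intro: sparse_subset)
    consider "?n - c = 4" | "?n - c = 5" | "6 \<le> ?n - c" using T by linarith
    then show ?thesis
    proof cases
      case 1
      then have "pair_sum s (V - T) \<le> 3"
        using sparse_card_4[OF sp] card pair_sum_s_le_t[of "V - T"] by simp
      moreover have "real ?n = real c + 4" using 1 by linarith
      ultimately show ?thesis using rem two l_le_2 c2 by (simp add: algebra_simps)
    next
      case 2
      then have "pair_sum s (V - T) \<le> 5"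
        using sparse_card_5[OF sp] card pair_sum_s_le_t[of "V - T"] by simp
      moreover have "real ?n = real c + 5" using 2 by linarith
      ultimately show ?thesis using rem two l_le_2 c2 by (simp add: algebra_simps)
    next
      case 3
      have "pair_sum s (V - T) \<le> max_turan_score l (?n - c)"
        using less.hyps[of "V - T"] sp card 3 T V by simp
      moreover have "max_turan_score l (?n - c) + real c \<le> max_turan_score l (?n - c + c)"
        using 3 T by (intro max_turan_score_add) auto
      moreover have "?n - c + c = ?n" using T by simp
      ultimately show ?thesis using rem by simp
    qed
  qed
  show ?case
  proof (cases "\<exists>T\<in>nsets V 3. 3 \<le> pair_sum t T")
    case True
    then obtain T where T: "T \<in> nsets V 3" "3 \<le> pair_sum t T" by blast
    show ?thesis
    proof (cases "?n = 6")
      case True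
      then have "pair_sum s V \<le> 6"
        using sparse_card_6_triple[OF V(1) True T] pair_sum_s_le_t[of V] by linarith
      then show ?thesis using two True l_le_2 by simp
    next
      case False
      have "pair_sum t (insert v T) \<le> 3" if "v \<in> V - T" for v
        using that T by (intro sparse_card_4 sparse_subset[OF V(1)]) (auto simp: nsets_def)
      then show ?thesis using T V False by (intro remove[of T 3]) (auto simp: nsets_def)
    qed
  next
    case noT: False
    then have T2: "pair_sum t T \<le> 2" if "T \<in> nsets V 3" for T using that by force
    show ?thesis
    \<comment> \<open>Heavy pairs come after heavy triples because \<open>T2\<close> then bounds
      every triple extending the pair.\<close>
    proof (cases "\<exists>e\<in>nsets V 2. 2 \<le> t e")
      case True
      then obtain x y where xy: "x \<in> V" "y \<in> V" "x \<noteq> y" "2 \<le> t {x, y}" by (auto elim!: nsets_2E)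
      have "pair_sum t (insert v {x, y}) \<le> 2" if "v \<in> V - {x, y}" for v
        using that xy by (intro T2) (auto simp: nsets_def)
      then show ?thesis using V xy by (intro remove[of "{x, y}" 2]) (auto simp: pair_sum_insert)
    next
      case False
      then have tame: "tame V" using V T2 by (intro sparse_tame) force+
      show ?thesis
      proof (cases "?n = 6")
        case True
        then show ?thesis using tame_card_6[OF tame V(1)] two by simp
      next
        case False
        then obtain n where n: "?n = Suc n" "6 \<le> n" using V by (cases ?n) auto
        have "pair_sum s (V - {v}) \<le> max_turan_score l n" if "v \<in> V" for v
        proof -
          have "card (V - {v}) = n" using n that fin by simp
          then show ?thesis
            using less.hyps[of "V - {v}"] n sparse_subset[OF V(1), of "V - {v}"] by auto
        qed
        then show ?thesis using tame_step[OF tame n] n by simp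
      qed
    qed
  qed
qed

end

section \<open>Logarithmic scores of multiplicities\<close>

definition score :: "nat \<Rightarrow> nat \<Rightarrow> real" where
  "score a k = (ln (real k) - ln (real a)) / (ln (real a + 1) - ln (real a))"

definition penalty :: "nat \<Rightarrow> real" where
  "penalty a = - score a (a - 1)"

lemma ln_Suc_diff_antimono:
  fixes i j :: nat
  assumes "1 \<le> i" "i \<le> j"
  shows "ln (real j + 1) - ln (real j) \<le> ln (real i + 1) - ln (real i)"
proof -
  have "ln ((real j + 1) / real j) \<le> ln ((real i + 1) / real i)"
    using assms by (subst ln_le_cancel_iff) (auto simp: field_simps)
  then show ?thesis using assms by (simp add: ln_div)
qed

text \<open>Telescoping: by concavity each unit step of \<open>ln\<close> below \<open>a\<close> is
  at least the step from \<open>a\<close> to \<open>a + 1\<close>.\<close>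

lemma ln_diff_ge_steps:
  fixes i j a :: nat
  assumes "1 \<le> i" "i \<le> j" "j \<le> a"
  shows "(real j - real i) * (ln (real a + 1) - ln (real a)) \<le> ln (real j) - ln (real i)"
  using assms(2,3)
proof (induction j rule: dec_induct)
  case (step j)
  then show ?case
    using ln_Suc_diff_antimono[of j a] assms(1) by (simp add: algebra_simps)
qed simp

lemma ln_diff_le_steps:
  fixes i a :: nat
  assumes "1 \<le> a" "a \<le> i"
  shows "ln (real i) - ln (real a) \<le> (real i - real a) * (ln (real a + 1) - ln (real a))"
  using assms(2)
proof (induction i rule: dec_induct)
  case (step i)
  then show ?case
    using ln_Suc_diff_antimono[of a i] assms(1) by (simp add: algebra_simps)
qed simp

lemma ln_Suc_diff_pos: "1 \<le> a \<Longrightarrow> 0 < ln (real a + 1) - ln (real a)"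
  by simp

lemma score_le:
  assumes "1 \<le> a" "1 \<le> k"
  shows "score a k \<le> real k - real a"
proof -
  have "ln (real k) - ln (real a) \<le> (real k - real a) * (ln (real a + 1) - ln (real a))"
    using ln_diff_le_steps[of a k] ln_diff_ge_steps[of k a a] assms
    by (cases "a \<le> k") (auto simp: algebra_simps)
  then show ?thesis
    unfolding score_def using ln_Suc_diff_pos[OF assms(1)] by (simp add: pos_divide_le_eq)
qed

text \<open>The step from \<open>a\<close> down to \<open>a - 1\<close> costs exactly
  \<open>penalty a\<close>; each of the further steps down to \<open>k\<close> costs at least
  \<open>1\<close>.\<close>

lemma score_less_le:
  assumes "1 \<le> k" "k < a"
  shows "score a k \<le> real k - real a + 1 - penalty a"
proof -
  let ?\<alpha> = "ln (real a + 1) - ln (real a)"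
  have pos: "0 < ?\<alpha>" using assms by simp
  have "(real (a - 1) - real k) * ?\<alpha> \<le> ln (real (a - 1)) - ln (real k)"
    using assms by (intro ln_diff_ge_steps) auto
  then have "(real (a - 1) - real k) * ?\<alpha> / ?\<alpha> \<le> (ln (real (a - 1)) - ln (real k)) / ?\<alpha>"
    using pos by (intro divide_right_mono) auto
  then have "real (a - 1) - real k \<le> (ln (real (a - 1)) - ln (real k)) / ?\<alpha>" using pos by simp
  also have "\<dots> = - penalty a - score a k"
    by (simp add: penalty_def score_def diff_divide_distrib)
  finally show ?thesis using assms by (simp add: of_nat_diff)
qed

lemma penalty_bounds:
  assumes "2 \<le> a"
  shows "1 \<le> penalty a" "penalty a \<le> 2"
proof -
  show "1 \<le> penalty a"
    using score_le[of a "a - 1"] assms by (simp add: penalty_def of_nat_diff)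
  define b where "b = real a - 1"
  have b: "1 \<le> b" "real (a - 1) = b" "real a = b + 1" using assms by (auto simp: b_def of_nat_diff)
  \<comment> \<open>Exponentiated form of \<open>penalty a \<le> 2\<close> with
    \<open>b = a - 1\<close>; expanded, it says \<open>1 \<le> b^2 + b\<close>.\<close>
  have "(b + 1) ^ 3 \<le> b * (b + 2) ^ 2"
    using b(1) by (simp add: power2_eq_square power3_eq_cube algebra_simps add_increasing2)
  then have "ln ((b + 1) ^ 3) \<le> ln (b * (b + 2) ^ 2)" using b by (subst ln_le_cancel_iff) auto
  then have "3 * ln (b + 1) \<le> ln b + 2 * ln (b + 2)"
    using b by (simp add: ln_mult ln_realpow)
  then have "ln (real a) - ln (real (a - 1)) \<le> 2 * (ln (real a + 1) - ln (real a))"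
    using b by (simp add: add.commute)
  then show "penalty a \<le> 2"
    using assms ln_Suc_diff_pos[of a]
    by (simp add: penalty_def score_def minus_divide_left pos_divide_le_eq)
qed

text \<open>The logarithm of the product is an increasing affine function of the total score, so
  comparing scores compares products.\<close>

lemma ln_edge_prod:
  assumes "finite (verts G)" "1 \<le> a" "\<And>e. e \<in> nsets (verts G) 2 \<Longrightarrow> 1 \<le> mult G e"
  shows "ln (real (edge_prod G)) = real (card (nsets (verts G) 2)) * ln (real a) +
    (ln (real a + 1) - ln (real a)) * pair_sum (\<lambda>e. score a (mult G e)) (verts G)"
proof -
  let ?\<alpha> = "ln (real a + 1) - ln (real a)"
  have fin: "finite (nsets (verts G) 2)" using assms(1) by (rule finite_imp_finite_nsets)
  have "ln (real (edge_prod G)) = (\<Sum>e\<in>nsets (verts G) 2. ln (real (mult G e)))"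
    unfolding edge_prod_def of_nat_prod using assms(3) fin by (intro ln_prod) force+
  also have "\<dots> = (\<Sum>e\<in>nsets (verts G) 2. ln (real a) + ?\<alpha> * score a (mult G e))"
    using ln_Suc_diff_pos[OF assms(2)] by (intro sum.cong) (auto simp: score_def)
  finally show ?thesis by (simp add: sum.distrib pair_sum_def sum_distrib_left)
qed

section \<open>Turan graphs and the return from scores to products\<close>

lemma turan_graphs_subset_sq_graphs:
  assumes "1 \<le> a"
  shows "turan_graphs 2 1 a n \<subseteq> sq_graphs n 4 (6 * a + 3)"
proof
  fix G assume "G \<in> turan_graphs 2 1 a n"
  then obtain V :: "nat \<Rightarrow> nat set" where G: "multigraph G" "verts G = {1..n}"
    and V: "disjoint_family_on V {..<2}" "(\<Union>i<2. V i) = {1..n}"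
    and mult: "\<And>e. e \<in> nsets {1..n} 2 \<Longrightarrow> mult G e =
      (if e \<subseteq> V 0 then a - 1 else if \<exists>i\<in>{1..<2}. e \<subseteq> V i then a else a + 1)"
    unfolding turan_graphs_def by auto
  have disj: "V 0 \<inter> V 1 = {}" using V(1) by (auto simp: disjoint_family_on_def)
  have un: "V 0 \<union> V 1 = {1..n}" using V(2) by (simp add: numeral_2_eq_2 lessThan_Suc Un_commute)
  have one: "{1..<2::nat} = {1}" by auto
  have "edge_sum G X \<le> 6 * a + 3" if X: "X \<in> nsets {1..n} 4" for X
  proof -
    have X': "X \<subseteq> {1..n}" "finite X" "card X = 4" using X by (auto simp: nsets_def)
    let ?A = "X \<inter> V 0" and ?B = "X \<inter> V 1"
    have AB: "?A \<union> ?B = X" "?A \<inter> ?B = {}" using X' un disj by auto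
    then have card: "card ?A + card ?B = 4" using X' card_Un_disjoint[of ?A ?B] by auto
    have in_V: "{x, y} \<in> nsets {1..n} 2" if "x \<in> X" "y \<in> X" "x \<noteq> y" for x y
      using that X' by (intro doubleton_in_nsets) auto
    have "pair_sum (\<lambda>e. int (mult G e)) (?A \<union> ?B) = of_nat (card ?A choose 2) * (int a - 1) +
        of_nat (card ?B choose 2) * int a + of_nat (card ?A * card ?B) * (int a + 1)"
    proof (rule pair_sum_two_parts)
      show "int (mult G {x, y}) = int a - 1" if "x \<in> ?A" "y \<in> ?A" "x \<noteq> y" for x y
        using that mult[OF in_V[of x y]] assms by (simp add: of_nat_diff)
      show "int (mult G {x, y}) = int a" if "x \<in> ?B" "y \<in> ?B" "x \<noteq> y" for x y
        using that mult[OF in_V[of x y]] disj by (auto simp: one)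
      show "int (mult G {x, y}) = int a + 1" if "x \<in> ?A" "y \<in> ?B" for x y
      proof -
        have "x \<noteq> y" "y \<notin> V 0" "x \<notin> V 1" using that disj by auto
        then show ?thesis using that mult[OF in_V[of x y]] unfolding one by simp
      qed
    qed (use X' AB in auto)
    \<comment> \<open>With \<open>k = card ?A\<close>, the excess over \<open>6 * a\<close> is
      \<open>k * (4 - k) - k * (k - 1) / 2\<close>, whose maximum \<open>3\<close> is attained at
      \<open>k = 1\<close> and \<open>k = 2\<close>.\<close>
    moreover have "card ?A \<in> {0, 1, 2, 3, 4}" "card ?B = 4 - card ?A" using card by auto
    ultimately have "pair_sum (\<lambda>e. int (mult G e)) X \<le> 6 * int a + 3"
      unfolding AB(1) by (auto simp: choose_two algebra_simps)
    then have "int (edge_sum G X) \<le> 6 * int a + 3" by (simp add: edge_sum_def pair_sum_def)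
    then show ?thesis by linarith
  qed
  then show "G \<in> sq_graphs n 4 (6 * a + 3)" using G by (simp add: sq_graphs_def)
qed

lemma turan_graph_exists:
  assumes "2 \<le> a" "m \<le> n"
  obtains G where "G \<in> turan_graphs 2 1 a n" "\<And>e. e \<in> nsets {1..n} 2 \<Longrightarrow> 1 \<le> mult G e"
    "pair_sum (\<lambda>e. score a (mult G e)) {1..n} = turan_score (penalty a) n m"
proof -
  let ?V = "\<lambda>i::nat. if i = 0 then {1..m} else {m+1..n}"
  let ?f = "\<lambda>e. if e \<subseteq> {1..m} then a - 1 else if e \<subseteq> {m+1..n} then a else a + 1"
  let ?G = "({1..n}, restrict ?f (nsets {1..n} 2))"
  have one: "{1..<2::nat} = {1}" by auto
  have un: "{1..m} \<union> {m+1..n} = {1..n}" using assms by auto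
  have "?G \<in> turan_graphs 2 1 a n"
    unfolding turan_graphs_def mem_Collect_eq
  proof (intro conjI exI[of _ ?V] ballI)
    show "multigraph ?G" by (auto simp: multigraph_def)
    show "(\<Union>i<2. ?V i) = {1..n}" using assms by (auto simp: numeral_2_eq_2 lessThan_Suc)
  qed (auto simp: disjoint_family_on_def one)
  moreover have "1 \<le> mult ?G e" if "e \<in> nsets {1..n} 2" for e using that assms by auto
  moreover have "pair_sum (\<lambda>e. score a (mult ?G e)) {1..n} = turan_score (penalty a) n m"
  proof -
    have in_V: "{x, y} \<in> nsets {1..n} 2" if "x \<in> {1..n}" "y \<in> {1..n}" "x \<noteq> y" for x y
      using that by (intro doubleton_in_nsets) auto
    have "pair_sum (\<lambda>e. score a (mult ?G e)) ({1..m} \<union> {m+1..n}) =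
      of_nat (card {1..m} choose 2) * (- penalty a) + of_nat (card {m+1..n} choose 2) * 0 +
      of_nat (card {1..m} * card {m+1..n}) * 1"
    proof (rule pair_sum_two_parts)
      show "score a (mult ?G {x, y}) = - penalty a" if "x \<in> {1..m}" "y \<in> {1..m}" "x \<noteq> y" for x y
        using that in_V[of x y] assms by (simp add: penalty_def)
      show "score a (mult ?G {x, y}) = 0" if "x \<in> {m+1..n}" "y \<in> {m+1..n}" "x \<noteq> y" for x y
        using that in_V[of x y] by (simp add: score_def)
      show "score a (mult ?G {x, y}) = 1" if "x \<in> {1..m}" "y \<in> {m+1..n}" for x y
        using that in_V[of x y] assms ln_Suc_diff_pos[of a] by (simp add: score_def add.commute)
    qed auto
    moreover have "real (m choose 2) = real m * (real m - 1) / 2"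
      by (cases m) (simp_all add: choose_two real_of_nat_div algebra_simps)
    ultimately show ?thesis
      using assms unfolding un by (simp add: turan_score_def of_nat_diff)
  qed
  ultimately show ?thesis using that by blast
qed

lemma sq_graphs_edge_prod_le:
  assumes a: "2 \<le> a" and n: "6 \<le> n" and G: "G \<in> sq_graphs n 4 (6 * a + 3)"
  shows "edge_prod G \<le> turan_prod 2 1 a n"
\<comment> \<open>A zero multiplicity has no meaningful logarithm, but it makes the whole product
  vanish.\<close>
proof (cases "\<forall>e\<in>nsets {1..n} 2. 1 \<le> mult G e")
  case False
  then have "edge_prod G = 0"
    using G by (force simp: edge_prod_def sq_graphs_def finite_imp_finite_nsets)
  then show ?thesis by simp
next
  case pos: True
  \<comment> \<open>\<open>mult G\<close> is undefined outside the pairs of vertices, while the locale needs a total score.\<close>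
  define w where "w e = max 1 (mult G e)" for e
  define t where "t e = int (w e) - int a" for e
  define s where "s e = score a (w e)" for e
  have w: "w e = mult G e" if "e \<in> nsets {1..n} 2" for e using pos that by (simp add: w_def max_def)
  interpret edge_scores "penalty a" t s
  proof
    fix e
    have "1 \<le> w e" by (simp add: w_def)
    then show "s e \<le> t e" "t e < 0 \<Longrightarrow> s e \<le> t e + 1 - penalty a"
      using score_le[of a "w e"] score_less_le[of "w e" a] a by (auto simp: s_def t_def)
  qed (use penalty_bounds[OF a] in auto)
  have "pair_sum t X \<le> 3" if X: "X \<in> nsets {1..n} 4" for X
  proof -
    have X': "X \<subseteq> {1..n}" "finite X" "card X = 4" using X by (auto simp: nsets_def)
    have "pair_sum t X = (\<Sum>e\<in>nsets X 2. int (mult G e) - int a)"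
      unfolding pair_sum_def t_def using X' nsets_mono[of X "{1..n}" 2] w by (intro sum.cong) auto
    also have "\<dots> = int (edge_sum G X) - 6 * int a"
      using X' by (simp add: sum_subtractf edge_sum_def card_nsets choose_two)
    finally show ?thesis using G X by (auto simp: sq_graphs_def)
  qed
  then have "sparse {1..n}" by (simp add: sparse_def)
  then have bound: "pair_sum s {1..n} \<le> max_turan_score (penalty a) n"
    using sparse_bound[of "{1..n}"] n by simp
  obtain m where m: "m \<le> n" "max_turan_score (penalty a) n = turan_score (penalty a) n m"
    by (rule max_turan_score_attained)
  obtain T where T: "T \<in> turan_graphs 2 1 a n" "\<And>e. e \<in> nsets {1..n} 2 \<Longrightarrow> 1 \<le> mult T e"
    "pair_sum (\<lambda>e. score a (mult T e)) {1..n} = turan_score (penalty a) n m"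
    using turan_graph_exists[OF a m(1)] by blast
  have V: "verts G = {1..n}" "verts T = {1..n}"
    using G T(1) by (auto simp: sq_graphs_def turan_graphs_def)
  have "pair_sum (\<lambda>e. score a (mult G e)) {1..n} = pair_sum s {1..n}"
    unfolding pair_sum_def s_def using w by (intro sum.cong) auto
  then have le: "pair_sum (\<lambda>e. score a (mult G e)) {1..n} \<le>
      pair_sum (\<lambda>e. score a (mult T e)) {1..n}"
    using bound m(2) T(3) by simp
  have "ln (real (edge_prod G)) \<le> ln (real (edge_prod T))"
    using ln_edge_prod[of G a] ln_edge_prod[of T a] V a pos T(2) mult_left_mono[OF le] by simp
  moreover have "0 < edge_prod G" "0 < edge_prod T"
    using pos T(2) V by (auto simp: edge_prod_def intro!: prod_pos) force+
  ultimately have "edge_prod G \<le> edge_prod T" by simp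
  also have "\<dots> \<le> turan_prod 2 1 a n"
    unfolding turan_prod_def using T(1) finite_turan_graphs by (intro Max_ge) auto
  finally show ?thesis .
qed

theorem theorem3p5:
  fixes a n :: nat
  assumes "a \<ge> 2" and "n \<ge> 30"
  shows "ex_prod n 4 ((4 choose 2) * a + 3) = turan_prod 2 1 a n"
proof (rule antisym)
  have six: "(4 choose 2) = (6::nat)" by (simp add: choose_two)
  have fin: "finite (sq_graphs n 4 (6 * a + 3))" using assms by (intro finite_sq_graphs) auto
  show "ex_prod n 4 ((4 choose 2) * a + 3) \<le> turan_prod 2 1 a n"
    unfolding ex_prod_def six
    using fin sq_graphs_nonempty[of n 4] sq_graphs_edge_prod_le assms by (intro Max.boundedI) auto
  show "turan_prod 2 1 a n \<le> ex_prod n 4 ((4 choose 2) * a + 3)"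
    unfolding ex_prod_def turan_prod_def six
    using fin turan_graphs_subset_sq_graphs[of a n] turan_graphs_nonempty[of 2 1 a n] assms
    by (intro Max_mono) auto
qed

end
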